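(* Let $\pi=(\pi_0,\dots,\pi_{n-1})$ be a stationary control policy of DP, and let $(u_0^*,\dots,u_{n-1}^* )$ and $(x_0^*,\dots,x_n^* )$ be the input and state sequences induced by $\pi$ from the initial state $x_0$. Suppose that for every $k\in\{0,\dots,n-1\}$: (1) $\pi_k$ is continuously differentiable in a neighborhood of $x_k^*$; and (2) either $\pi_k(x_k^* )$ is in the interior of $A$, or $\mathbf{D}_k^\pi(x_k^* )=0$, where $\mathbf{D}_k^\pi(x)$ is the Jacobian matrix of $\pi_k$ at $x$. Then $(u_0^*,\dots,u_{n-1}^* )$ is a stationary point of the one-shot optimization.
   Context: Setting (deterministic optimal control): horizon $n$, states in $\mathbb{R}^N$, compact action space $A\subseteq\mathbb{R}^M$, dynamics $f_k:\mathbb{R}^N\times\mathbb{R}^M\to\mathbb{R}^N$ and stage costs $c_k:\mathbb{R}^N\times\mathbb{R}^M\to\mathbb{R}$ ($k=0,\dots,n-1$), terminal cost $c_n:\mathbb{R}^N\to\mathbb{R}$, all at least twice continuously differentiable; the initial state $x_0$ is given. Cost of an input sequence: $C(x)=c_n(x)$ (no inputs), and $C(x;u_k,\dots,u_{n-1})=c_k(x,u_k)+C(f_k(x,u_k);u_{k+1},\dots,u_{n-1})$. The one-shot problem is $\min_{u_0,\dots,u_{n-1}\in A}C(x_0;u_0,\dots,u_{n-1})$. A control policy is $\pi=(\pi_0,\dots,\pi_{n-1})$ with $\pi_k:\mathbb{R}^N\to A$. Its Q-functions and cost-to-go functions are defined backward by $J_n^\pi(x)=c_n(x)$, $Q_k^\pi(x,u)=c_k(x,u)+J_{k+1}^\pi(f_k(x,u))$,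 $J_k^\pi(x)=Q_k^\pi(x,\pi_k(x))$, $k=n-1,\dots,0$. The induced sequences from $x_0$ are $x_0^*=x_0$, $u_k^*=\pi_k(x_k^* )$, $x_{k+1}^*=f_k(x_k^*,u_k^* )$. Normal cone: for a set $S$ and $s^*\in S$, $\mathcal{N}_S(s^* )$ denotes the normal cone of $S$ at $s^*$, i.e. the set of $v$ with $\langle v,s-s^*\rangle\le o(\|s-s^*\|)$ for $s\in S$, $s\to s^*$. Stationary point of the one-shot optimization: $(u_0^*,\dots,u_{n-1}^* )\in A^n$ with $-\nabla_{u_k}C(x_0;u_0^*,\dots,u_{n-1}^* )\in\mathcal{N}_A(u_k^* )$ for all $k\in\{0,\dots,n-1\}$. Stationary control policy of DP: $\pi$ such that for all $k\in\{0,\dots,n-1\}$ and all $x\in\mathbb{R}^N$, $-\nabla_uQ_k^\pi(x,\pi_k(x))\in\mathcal{N}_A(\pi_k(x))$ (the gradient being understood to exist). *)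

theory Defs
  imports "HOL-Analysis.Analysis" "HOL-Library.Landau_Symbols"
begin

text \<open>
  The horizon is \<open>n\<close>; the dynamics \<open>f k\<close> and stage costs \<open>c k\<close> matter only for \<open>k < n\<close>.
  The terminal cost \<open>c\<^sub>n\<close> depends on the state alone, so it has a different type from the
  stage costs and is the separate parameter \<open>cT\<close>.
\<close>

definition continuously_differentiable_on ::
    "('a::real_normed_vector \<Rightarrow> 'b::real_normed_vector) \<Rightarrow> 'a set \<Rightarrow> bool" where
  "continuously_differentiable_on g S \<longleftrightarrow>
     (\<exists>g' :: 'a \<Rightarrow> 'a \<Rightarrow>\<^sub>L 'b.
        (\<forall>x\<in>S. (g has_derivative blinfun_apply (g' x)) (at x)) \<and> continuous_on S g')"

definition twice_continuously_differentiable_on ::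
    "('a::real_normed_vector \<Rightarrow> 'b::real_normed_vector) \<Rightarrow> 'a set \<Rightarrow> bool" where
  "twice_continuously_differentiable_on g S \<longleftrightarrow>
     (\<exists>g' :: 'a \<Rightarrow> 'a \<Rightarrow>\<^sub>L 'b.
        (\<forall>x\<in>S. (g has_derivative blinfun_apply (g' x)) (at x)) \<and>
        continuously_differentiable_on g' S)"

definition normal_cone :: "'a::real_inner set \<Rightarrow> 'a \<Rightarrow> 'a set" where
  "normal_cone S s =
     {v. \<exists>r. r \<in> o[at s within S](\<lambda>t. norm (t - s)) \<and>
             (\<forall>\<^sub>F t in at s within S. v \<bullet> (t - s) \<le> r t)}"

text \<open>
  \<open>cost f c cT k x [u\<^sub>k, \<dots>, u\<^sub>n\<^sub>-\<^sub>1]\<close> is \<open>C(x; u\<^sub>k, \<dots>, u\<^sub>n\<^sub>-\<^sub>1)\<close>; the argument \<open>k\<close> is the stage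
  of the first input in the list.
\<close>

primrec cost ::
    "(nat \<Rightarrow> 'x \<Rightarrow> 'u \<Rightarrow> 'x) \<Rightarrow> (nat \<Rightarrow> 'x \<Rightarrow> 'u \<Rightarrow> real) \<Rightarrow> ('x \<Rightarrow> real) \<Rightarrow>
     nat \<Rightarrow> 'x \<Rightarrow> 'u list \<Rightarrow> real" where
  "cost f c cT k x [] = cT x"
| "cost f c cT k x (u # us) = c k x u + cost f c cT (Suc k) (f k x u) us"

text \<open>
  The backward recursion for \<open>J\<^sub>k\<close> and \<open>Q\<^sub>k\<close>, with \<open>Q\<^sub>k\<close> unfolded inside \<open>J\<^sub>k\<close>; the mutual form
  is \<open>cost_to_go_terminal\<close> and \<open>cost_to_go_eq_Q\<close> below. Values at \<open>k > n\<close> are irrelevant.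
\<close>

function cost_to_go ::
    "nat \<Rightarrow> (nat \<Rightarrow> 'x \<Rightarrow> 'u \<Rightarrow> 'x) \<Rightarrow> (nat \<Rightarrow> 'x \<Rightarrow> 'u \<Rightarrow> real) \<Rightarrow> ('x \<Rightarrow> real) \<Rightarrow>
     (nat \<Rightarrow> 'x \<Rightarrow> 'u) \<Rightarrow> nat \<Rightarrow> 'x \<Rightarrow> real" where
  "cost_to_go n f c cT \<pi> k x =
     (if k < n then c k x (\<pi> k x) + cost_to_go n f c cT \<pi> (Suc k) (f k x (\<pi> k x)) else cT x)"
  by pat_completeness auto
termination
  by (relation "Wellfounded.measure (\<lambda>(n, f, c, cT, \<pi>, k, x). n - k)") auto

declare cost_to_go.simps [simp del]

definition Q_function ::
    "nat \<Rightarrow> (nat \<Rightarrow> 'x \<Rightarrow> 'u \<Rightarrow> 'x) \<Rightarrow> (nat \<Rightarrow> 'x \<Rightarrow> 'u \<Rightarrow> real) \<Rightarrow> ('x \<Rightarrow> real) \<Rightarrow>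
     (nat \<Rightarrow> 'x \<Rightarrow> 'u) \<Rightarrow> nat \<Rightarrow> 'x \<Rightarrow> 'u \<Rightarrow> real" where
  "Q_function n f c cT \<pi> k x u = c k x u + cost_to_go n f c cT \<pi> (Suc k) (f k x u)"

lemma cost_to_go_terminal: "cost_to_go n f c cT \<pi> n x = cT x"
  by (simp add: cost_to_go.simps)

lemma cost_to_go_eq_Q:
  "k < n \<Longrightarrow> cost_to_go n f c cT \<pi> k x = Q_function n f c cT \<pi> k x (\<pi> k x)"
  by (simp add: cost_to_go.simps [of n f c cT \<pi> k] Q_function_def)

primrec induced_state ::
    "(nat \<Rightarrow> 'x \<Rightarrow> 'u \<Rightarrow> 'x) \<Rightarrow> (nat \<Rightarrow> 'x \<Rightarrow> 'u) \<Rightarrow> 'x \<Rightarrow> nat \<Rightarrow> 'x" where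
  "induced_state f \<pi> x0 0 = x0"
| "induced_state f \<pi> x0 (Suc k) =
     f k (induced_state f \<pi> x0 k) (\<pi> k (induced_state f \<pi> x0 k))"

definition induced_inputs ::
    "nat \<Rightarrow> (nat \<Rightarrow> 'x \<Rightarrow> 'u \<Rightarrow> 'x) \<Rightarrow> (nat \<Rightarrow> 'x \<Rightarrow> 'u) \<Rightarrow> 'x \<Rightarrow> 'u list" where
  "induced_inputs n f \<pi> x0 = map (\<lambda>k. \<pi> k (induced_state f \<pi> x0 k)) [0..<n]"

text \<open>
  In both stationarity notions the gradient is required to exist; it is then unique, being
  the Riesz representative of the Frechet derivative.
\<close>

definition stationary_point ::
    "nat \<Rightarrow> 'u::real_inner set \<Rightarrow> (nat \<Rightarrow> 'x \<Rightarrow> 'u \<Rightarrow> 'x) \<Rightarrow> (nat \<Rightarrow> 'x \<Rightarrow> 'u \<Rightarrow> real) \<Rightarrow>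
     ('x \<Rightarrow> real) \<Rightarrow> 'x \<Rightarrow> 'u list \<Rightarrow> bool" where
  "stationary_point n A f c cT x0 us \<longleftrightarrow>
     length us = n \<and> set us \<subseteq> A \<and>
     (\<forall>k<n. \<exists>g. GDERIV (\<lambda>v. cost f c cT 0 x0 (us[k := v])) (us ! k) :> g \<and>
                - g \<in> normal_cone A (us ! k))"

definition stationary_policy ::
    "nat \<Rightarrow> 'u::real_inner set \<Rightarrow> (nat \<Rightarrow> 'x \<Rightarrow> 'u \<Rightarrow> 'x) \<Rightarrow> (nat \<Rightarrow> 'x \<Rightarrow> 'u \<Rightarrow> real) \<Rightarrow>
     ('x \<Rightarrow> real) \<Rightarrow> (nat \<Rightarrow> 'x \<Rightarrow> 'u) \<Rightarrow> bool" where
  "stationary_policy n A f c cT \<pi> \<longleftrightarrow>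
     (\<forall>k<n. \<forall>x. \<pi> k x \<in> A \<and>
        (\<exists>g. GDERIV (\<lambda>u. Q_function n f c cT \<pi> k x u) (\<pi> k x) :> g \<and>
             - g \<in> normal_cone A (\<pi> k x)))"

end

theory Submission
  imports Defs
begin

text \<open>
  Only first-order information at the induced trajectory matters. By backward induction, the
  cost-to-go \<open>J\<^sub>k\<close> and the open-loop tail cost \<open>x \<mapsto> C(x; u\<^sub>k\<^sup>*, \<dots>, u\<^sub>n\<^sub>-\<^sub>1\<^sup>*)\<close> are differentiable
  at \<open>x\<^sub>k\<^sup>*\<close> with the same derivative: by the chain rule they differ by the term
  \<open>\<nabla>\<^sub>u Q\<^sub>k \<bullet> D\<pi>\<^sub>k\<close>, which vanishes because either \<open>D\<pi>\<^sub>k = 0\<close>, or \<open>u\<^sub>k\<^sup>*\<close> is interior and the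
  normal cone there is trivial. Hence the partial gradient of the one-shot cost in \<open>u\<^sub>k\<close> equals
  \<open>\<nabla>\<^sub>u Q\<^sub>k\<close>, and the stationarity of \<open>\<pi>\<close> at \<open>x\<^sub>k\<^sup>*\<close> is the claim.
\<close>

text \<open>At an interior point the filter \<open>at s within S\<close> is just
  \<open>at s\<close>, so a nonzero \<open>v\<close> can be tested along its own ray: there
  \<open>v \<bullet> (t - s)\<close> equals \<open>norm v * norm (t - s)\<close>, which is not
  small-o of \<open>norm (t - s)\<close>.\<close>

lemma normal_cone_interior:
  fixes s :: "'a::real_inner"
  assumes "s \<in> interior S"
  shows "normal_cone S s \<subseteq> {0}"
proof
  fix v assume "v \<in> normal_cone S s"
  then obtain r where r: "r \<in> o[at s](\<lambda>t. norm (t - s))"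
    and le: "\<forall>\<^sub>F t in at s. v \<bullet> (t - s) \<le> r t"
    unfolding normal_cone_def at_within_interior[OF assms] by blast
  show "v \<in> {0}"
  proof (rule ccontr)
    assume "v \<notin> {0}"
    then have v: "norm v > 0" by simp
    have "\<forall>\<^sub>F t in at s. norm (r t) \<le> norm v / 2 * norm (norm (t - s))"
      using landau_o.smallD[OF r, of "norm v / 2"] v by simp
    with le have "\<forall>\<^sub>F t in at s. v \<bullet> (t - s) \<le> norm v / 2 * norm (t - s)"
      by eventually_elim auto
    then obtain d where "d > 0"
      and d: "\<And>t. t \<noteq> s \<Longrightarrow> dist t s < d \<Longrightarrow> v \<bullet> (t - s) \<le> norm v / 2 * norm (t - s)"
      by (auto simp: eventually_at)
    \<comment> \<open>With this choice \<open>s + e *\<^sub>R v\<close> lies at distance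
      \<open>d / 2\<close> from \<open>s\<close>, inside the punctured ball given by
      \<open>d\<close>.\<close>
    define e where "e = d / (2 * norm v)"
    have e: "e > 0" "e * norm v < d"
      using v \<open>d > 0\<close> by (auto simp: e_def)
    have "v \<bullet> (e *\<^sub>R v) \<le> norm v / 2 * norm (e *\<^sub>R v)"
      using d[of "s + e *\<^sub>R v"] e v by (auto simp: dist_norm)
    then have "e * (norm v)\<^sup>2 \<le> e * (norm v)\<^sup>2 / 2"
      using e by (simp add: power2_norm_eq_inner[symmetric] power2_eq_square)
    moreover have "e * (norm v)\<^sup>2 > 0" using e v by simp
    ultimately show False by simp
  qed
qed

lemma twice_continuously_differentiable_on_has_derivative:
  assumes "twice_continuously_differentiable_on g S" "x \<in> S"
  obtains g' where "(g has_derivative g') (at x)"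
  using assms unfolding twice_continuously_differentiable_on_def by blast

text \<open>The costs of the first \<open>k\<close> stages sum to \<open>b\<close>, chosen before
  \<open>vs\<close> and hence independent of the later inputs. Its value stays existential because
  differentiation removes it.\<close>

lemma cost_induced_prefix:
  "\<exists>b. \<forall>vs. cost f c cT 0 x0 (map (\<lambda>j. \<pi> j (induced_state f \<pi> x0 j)) [0..<k] @ vs) =
          b + cost f c cT k (induced_state f \<pi> x0 k) vs"
proof (induction k)
  case 0
  show ?case by (intro exI[of _ 0]) simp
next
  case (Suc k)
  then obtain b where b:
    "\<And>vs. cost f c cT 0 x0 (map (\<lambda>j. \<pi> j (induced_state f \<pi> x0 j)) [0..<k] @ vs) =
        b + cost f c cT k (induced_state f \<pi> x0 k) vs"
    by blast
  show ?case
    by (intro exI[of _ "b + c k (induced_state f \<pi> x0 k) (\<pi> k (induced_state f \<pi> x0 k))"])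
      (simp add: b)
qed

lemma length_induced_inputs [simp]: "length (induced_inputs n f \<pi> x0) = n"
  by (simp add: induced_inputs_def)

lemma nth_induced_inputs [simp]:
  "k < n \<Longrightarrow> induced_inputs n f \<pi> x0 ! k = \<pi> k (induced_state f \<pi> x0 k)"
  by (simp add: induced_inputs_def)

text \<open>This isolates how the one-shot cost depends on its \<open>k\<close>-th input: up to a
  constant it is \<open>Q_function\<close> at the induced state, with the open-loop tail in place of
  the cost-to-go.\<close>

lemma cost_induced_update:
  assumes "k < n"
  shows "\<exists>b. \<forall>v. cost f c cT 0 x0 ((induced_inputs n f \<pi> x0)[k := v]) =
           b + (c k (induced_state f \<pi> x0 k) v +
             cost f c cT (Suc k) (f k (induced_state f \<pi> x0 k) v)
               (drop (Suc k) (induced_inputs n f \<pi> x0)))"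
proof -
  have "take k (induced_inputs n f \<pi> x0) = map (\<lambda>j. \<pi> j (induced_state f \<pi> x0 j)) [0..<k]"
    using assms by (simp add: induced_inputs_def take_map)
  then have "(induced_inputs n f \<pi> x0)[k := v] =
      map (\<lambda>j. \<pi> j (induced_state f \<pi> x0 j)) [0..<k] @ v # drop (Suc k) (induced_inputs n f \<pi> x0)" for v
    using assms by (simp add: upd_conv_take_nth_drop)
  then show ?thesis
    using cost_induced_prefix[of f c cT x0 \<pi> k] by auto
qed

text \<open>Chain rule with a generic \<open>J\<close>, so that it serves both the cost-to-go and
  the open-loop tail. Differentiability of \<open>J\<close> is asked at one point only, which is all
  the backward induction supplies.\<close>

lemma has_derivative_stage_Q:
  assumes f: "((\<lambda>(x, u). f x u) has_derivative f') (at (x, u))"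
    and c: "((\<lambda>(x, u). c x u) has_derivative c') (at (x, u))"
    and J: "(J has_derivative J') (at (f x u))"
  shows "((\<lambda>(x, u). c x u + J (f x u)) has_derivative (\<lambda>h. c' h + J' (f' h))) (at (x, u))"
proof -
  have "((\<lambda>p. J (case p of (x, u) \<Rightarrow> f x u)) has_derivative (\<lambda>h. J' (f' h))) (at (x, u))"
    by (rule has_derivative_compose[OF f]) (use J in simp)
  from has_derivative_add[OF c this] show ?thesis
    by (simp add: case_prod_unfold)
qed

lemma has_derivative_Pair_compose:
  assumes Q: "((\<lambda>(x, u). Q x u) has_derivative Q') (at (p t, q t))"
    and p: "(p has_derivative p') (at t)" and q: "(q has_derivative q') (at t)"
  shows "((\<lambda>t. Q (p t) (q t)) has_derivative (\<lambda>h. Q' (p' h, q' h))) (at t)"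
  using has_derivative_compose[OF has_derivative_Pair[OF p q] Q] by simp

theorem theorem2:
  fixes n :: nat
    and A :: "(real ^ 'm) set"
    and f :: "nat \<Rightarrow> real ^ 'n \<Rightarrow> real ^ 'm \<Rightarrow> real ^ 'n"
    and c :: "nat \<Rightarrow> real ^ 'n \<Rightarrow> real ^ 'm \<Rightarrow> real"
    and cT :: "real ^ 'n \<Rightarrow> real"
    and \<pi> :: "nat \<Rightarrow> real ^ 'n \<Rightarrow> real ^ 'm"
    and x0 :: "real ^ 'n"
  assumes "compact A"
    and "\<And>k. k < n \<Longrightarrow> twice_continuously_differentiable_on (\<lambda>(x, u). f k x u) UNIV"
    and "\<And>k. k < n \<Longrightarrow> twice_continuously_differentiable_on (\<lambda>(x, u). c k x u) UNIV"
    and "twice_continuously_differentiable_on cT UNIV"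
    and "stationary_policy n A f c cT \<pi>"
    and "\<And>k. k < n \<Longrightarrow>
           \<exists>U. open U \<and> induced_state f \<pi> x0 k \<in> U \<and> continuously_differentiable_on (\<pi> k) U"
    and "\<And>k. k < n \<Longrightarrow>
           \<pi> k (induced_state f \<pi> x0 k) \<in> interior A \<or>
           jacobian (\<pi> k) (at (induced_state f \<pi> x0 k)) = 0"
  shows "stationary_point n A f c cT x0 (induced_inputs n f \<pi> x0)"
proof -
  define X where "X = induced_state f \<pi> x0"
  define U where "U = (\<lambda>k. \<pi> k (X k))"
  define us where "us = induced_inputs n f \<pi> x0"
  have X_Suc: "X (Suc k) = f k (X k) (U k)" for k
    by (simp add: X_def U_def)
  have us_nth: "us ! k = U k" if "k < n" for k
    using that by (simp add: us_def U_def X_def)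
  have us_length: "length us = n"
    by (simp add: us_def)
  let ?J = "cost_to_go n f c cT \<pi>"
  let ?T = "\<lambda>k x. cost f c cT k x (drop k us)"
  \<comment> \<open>A common derivative \<open>D\<close> of both continuations at the next state
    yields one joint derivative \<open>Q'\<close> in state and input for both stage functions. Both
    the induction and the final gradient computation rest on this.\<close>
  have stage: "\<exists>g Q'.
      - g \<in> normal_cone A (U k) \<and> (\<forall>e. Q' (0, e) = g \<bullet> e) \<and> linear Q' \<and>
      ((\<lambda>(x, u). c k x u + ?J (Suc k) (f k x u)) has_derivative Q') (at (X k, U k)) \<and>
      ((\<lambda>(x, u). c k x u + ?T (Suc k) (f k x u)) has_derivative Q') (at (X k, U k))"
    if k: "k < n" and J: "(?J (Suc k) has_derivative D) (at (X (Suc k)))"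
      and T: "(?T (Suc k) has_derivative D) (at (X (Suc k)))" for k D
  proof -
    obtain f' where f': "((\<lambda>(x, u). f k x u) has_derivative f') (at (X k, U k))"
      using twice_continuously_differentiable_on_has_derivative[OF assms(2)[OF k] UNIV_I] .
    obtain c' where c': "((\<lambda>(x, u). c k x u) has_derivative c') (at (X k, U k))"
      using twice_continuously_differentiable_on_has_derivative[OF assms(3)[OF k] UNIV_I] .
    define Q' where "Q' = (\<lambda>h. c' h + D (f' h))"
    have QJ: "((\<lambda>(x, u). c k x u + ?J (Suc k) (f k x u)) has_derivative Q') (at (X k, U k))"
      unfolding Q'_def by (rule has_derivative_stage_Q[OF f' c']) (use J in \<open>simp add: X_Suc\<close>)
    have QT: "((\<lambda>(x, u). c k x u + ?T (Suc k) (f k x u)) has_derivative Q') (at (X k, U k))"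
      unfolding Q'_def by (rule has_derivative_stage_Q[OF f' c']) (use T in \<open>simp add: X_Suc\<close>)
    obtain g where g: "GDERIV (Q_function n f c cT \<pi> k (X k)) (U k) :> g"
      and cone: "- g \<in> normal_cone A (U k)"
      using assms(5) k unfolding stationary_policy_def U_def by blast
    \<comment> \<open>Freezing the state turns \<open>Q'\<close> into the partial derivative in the
      input; uniqueness of derivatives then identifies it with the gradient \<open>g\<close>
      provided by the policy.\<close>
    have "(Q_function n f c cT \<pi> k (X k) has_derivative (\<lambda>e. Q' (0, e))) (at (U k))"
      unfolding Q_function_def
      by (rule has_derivative_Pair_compose[OF QJ has_derivative_const has_derivative_ident])
    with g have "(\<lambda>e. Q' (0, e)) = (\<lambda>e. e \<bullet> g)"
      unfolding gderiv_def by (rule has_derivative_unique[rotated])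
    then have "\<forall>e. Q' (0, e) = g \<bullet> e"
      by (metis inner_commute)
    with cone QJ QT has_derivative_linear[OF QJ] show ?thesis by blast
  qed
  have tail: "\<exists>D. (?J k has_derivative D) (at (X k)) \<and> (?T k has_derivative D) (at (X k))"
    if "k \<le> n" for k
    using that
  proof (induction k rule: inc_induct)
    case base
    obtain D where "(cT has_derivative D) (at (X n))"
      using twice_continuously_differentiable_on_has_derivative[OF assms(4) UNIV_I] .
    moreover have "?J n = cT" "?T n = cT"
      by (auto simp: cost_to_go_terminal us_length)
    ultimately show ?case by auto
  next
    case (step k)
    then obtain D where "(?J (Suc k) has_derivative D) (at (X (Suc k)))"
      "(?T (Suc k) has_derivative D) (at (X (Suc k)))"
      by blast
    from stage[OF \<open>k < n\<close> this] obtain g Q' where cone: "- g \<in> normal_cone A (U k)"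
      and g: "\<And>e. Q' (0, e) = g \<bullet> e" and lin: "linear Q'"
      and QJ: "((\<lambda>(x, u). c k x u + ?J (Suc k) (f k x u)) has_derivative Q') (at (X k, U k))"
      and QT: "((\<lambda>(x, u). c k x u + ?T (Suc k) (f k x u)) has_derivative Q') (at (X k, U k))"
      by blast
    have "\<pi> k differentiable (at (X k))"
      using assms(6)[OF \<open>k < n\<close>]
      unfolding continuously_differentiable_on_def differentiable_def X_def by blast
    then have P: "(\<pi> k has_derivative (\<lambda>h. jacobian (\<pi> k) (at (X k)) *v h)) (at (X k))"
      by (simp add: jacobian_works)
    have "g = 0 \<or> jacobian (\<pi> k) (at (X k)) = 0"
      using assms(7)[OF \<open>k < n\<close>] cone normal_cone_interior[of "U k" A]
      unfolding U_def X_def by fastforce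
    \<comment> \<open>By linearity the two sides differ by \<open>Q'\<close> at
      \<open>(0, jacobian (\<pi> k) (at (X k)) *v h)\<close>, the inner product of \<open>g\<close>
      with the policy's response to \<open>h\<close>; one of the two factors is zero.\<close>
    then have "Q' (h, jacobian (\<pi> k) (at (X k)) *v h) = Q' (h, 0)" for h
      using linear_add[OF lin, of "(h, 0)" "(0, jacobian (\<pi> k) (at (X k)) *v h)"]
      by (auto simp: g)
    with has_derivative_Pair_compose[OF QJ[unfolded U_def] has_derivative_ident P]
    have "((\<lambda>x. c k x (\<pi> k x) + ?J (Suc k) (f k x (\<pi> k x))) has_derivative (\<lambda>h. Q' (h, 0)))
        (at (X k))"
      by simp
    moreover have "?J k = (\<lambda>x. c k x (\<pi> k x) + ?J (Suc k) (f k x (\<pi> k x)))"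
      using \<open>k < n\<close> by (auto simp: cost_to_go.simps[of n f c cT \<pi> k])
    \<comment> \<open>In the open-loop tail the input is held at \<open>U k\<close>, so its
      direction is 0 and the same derivative appears without any cancellation.\<close>
    moreover have "((\<lambda>x. c k x (U k) + ?T (Suc k) (f k x (U k))) has_derivative (\<lambda>h. Q' (h, 0)))
        (at (X k))"
      by (rule has_derivative_Pair_compose[OF QT has_derivative_ident has_derivative_const])
    moreover have "?T k = (\<lambda>x. c k x (U k) + ?T (Suc k) (f k x (U k)))"
      using \<open>k < n\<close> by (simp add: Cons_nth_drop_Suc[symmetric] us_length us_nth)
    ultimately show ?case by auto
  qed
  have "\<exists>g. GDERIV (\<lambda>v. cost f c cT 0 x0 (us[k := v])) (us ! k) :> g \<and>
            - g \<in> normal_cone A (us ! k)" if k: "k < n" for k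
  proof -
    obtain D where "(?J (Suc k) has_derivative D) (at (X (Suc k)))"
      "(?T (Suc k) has_derivative D) (at (X (Suc k)))"
      using tail[of "Suc k"] k by auto
    from stage[OF k this] obtain g Q' where cone: "- g \<in> normal_cone A (U k)"
      and g: "\<And>e. Q' (0, e) = g \<bullet> e"
      and QT: "((\<lambda>(x, u). c k x u + ?T (Suc k) (f k x u)) has_derivative Q') (at (X k, U k))"
      by blast
    obtain b where b: "\<And>v. cost f c cT 0 x0 (us[k := v]) =
        b + (c k (X k) v + ?T (Suc k) (f k (X k) v))"
      using cost_induced_update[OF k, of f c cT x0 \<pi>] unfolding us_def X_def by blast
    \<comment> \<open>The open-loop stage function shares \<open>Q'\<close>, so its partial
      derivative in the input is again represented by \<open>g\<close>.\<close>
    have "((\<lambda>v. c k (X k) v + ?T (Suc k) (f k (X k) v)) has_derivative (\<lambda>e. Q' (0, e)))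
        (at (U k))"
      by (rule has_derivative_Pair_compose[OF QT has_derivative_const has_derivative_ident])
    then have "((\<lambda>v. cost f c cT 0 x0 (us[k := v])) has_derivative (\<lambda>e. Q' (0, e))) (at (U k))"
      unfolding b using has_derivative_add[OF has_derivative_const] by fastforce
    then have "GDERIV (\<lambda>v. cost f c cT 0 x0 (us[k := v])) (U k) :> g"
      by (simp add: gderiv_def g inner_commute)
    with cone show ?thesis using us_nth[OF k] by auto
  qed
  moreover have "set us \<subseteq> A"
    using assms(5) by (auto simp: us_def induced_inputs_def stationary_policy_def)
  ultimately show ?thesis
    unfolding stationary_point_def us_def[symmetric] using us_length by blast
qed

end
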